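(* Let $n\ge1$, $K\ge2$ be integers and $B_1>0$. Let $\pi$ be the Exp3-$\gamma$ strategy (defined in the context) with prior $$\rho_i=\begin{cases}\exp\left(-\frac{B_1^2}{4Kn}\right)&\text{if } i=1,\\ (1-\rho_1)/(K-1)&\text{otherwise,}\end{cases}$$ and learning rate $\eta=B_1/(2Kn)$. Then in the adversarial $K$-armed bandit problem with gains in $[0,1]$ and horizon $n$, for every adversary, $$R^\pi_g\le\begin{cases}B_1&\text{if } i^*=1,\\[2pt] \frac{B_1}{2}+\frac{2Kn}{B_1}\log\left(\frac{4Kn(K-1)}{B_1^2}\right)&\text{otherwise.}\end{cases}$$
   Context: Adversarial bandit: $g_{i,t}\in[0,1]$ is the gain of action $i\in\{1,\dots,K\}$ at time step $t\in\{1,\dots,n\}$, chosen arbitrarily by the adversary before the learner's action $I_t$ is drawn, and possibly depending on the learner's past actions $I_1,\dots,I_{t-1}$. In round $t$ the learner picks $I_t$ and observes only $g_{I_t,t}$. The regret is $$R^\pi_g=\max_{i\in\{1,\dots,K\}}\mathbb E\Big[\sum_{t=1}^n\big(g_{i,t}-g_{I_t,t}\big)\Big],$$ and $i^*$ denotes an action attaining this maximum (the best action in hindsight). Exp3-$\gamma$ with prior $\rho\in[0,1]^K$, $\sum_i\rho_i=1$, and learning rate $\eta>0$: set $w_{i,0}=\rho_i$ for each $i$. For $t=1,\dots,n$: let $p_{i,t}=w_{i,t-1}/\sum_{j=1}^Kw_{j,t-1}$; choose action $I_t=i$ with probability $p_{i,t}$ (given the past) and observe $g_{I_t,t}$; set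 $\tilde\ell_{i,t}=\frac{(1-g_{i,t})\mathbf 1\{I_t=i\}}{p_{i,t}}$ and $w_{i,t}=w_{i,t-1}\exp(-\eta\tilde\ell_{i,t})$ for each $i$. *)

theory Defs
  imports "HOL-Probability.Probability"
begin

text \<open>
  The interaction between learner and adversary is a process on a probability space \<open>M\<close>. The
  \<open>\<sigma>\<close>-algebra \<open>F t\<close> is the past available to the adversary after round \<open>t\<close>: it contains the
  actions of rounds \<open>1, \<dots>, t\<close> and, since the gains of round \<open>t\<close> are \<open>F (t - 1)\<close>-measurable, the
  gains of rounds \<open>1, \<dots>, t + 1\<close>. The gains may therefore depend on the learner's past
  actions, but not on the action of the current round. An adversary that is a deterministic
  function of the past actions is the case where \<open>F\<close> is generated by the actions; a larger
  \<open>F\<close> allows the adversary to randomise. Only rounds \<open>1, \<dots>, n\<close> are constrained.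
\<close>

locale adversarial_bandit = prob_space M + filtration "space M" F
  for M :: "'a measure" and F :: "nat \<Rightarrow> 'a measure" +
  fixes K n :: nat
    and g :: "nat \<Rightarrow> nat \<Rightarrow> 'a \<Rightarrow> real"
    and I :: "nat \<Rightarrow> 'a \<Rightarrow> nat"
  assumes past_subalgebra: "\<And>t. subalgebra M (F t)"
    and gain_predictable: "\<And>i t. i \<in> {1..K} \<Longrightarrow> t \<in> {1..n} \<Longrightarrow> g i t \<in> borel_measurable (F (t - 1))"
    and gain_range: "\<And>i t \<omega>. i \<in> {1..K} \<Longrightarrow> t \<in> {1..n} \<Longrightarrow> \<omega> \<in> space M \<Longrightarrow> g i t \<omega> \<in> {0..1}"
    and action_adapted: "\<And>t. t \<in> {1..n} \<Longrightarrow> I t \<in> measurable (F t) (count_space {1..K})"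

definition regret_against ::
  "'a measure \<Rightarrow> nat \<Rightarrow> (nat \<Rightarrow> nat \<Rightarrow> 'a \<Rightarrow> real) \<Rightarrow> (nat \<Rightarrow> 'a \<Rightarrow> nat) \<Rightarrow> nat \<Rightarrow> real" where
  "regret_against M n g I i = (\<integral>\<omega>. (\<Sum>t=1..n. g i t \<omega> - g (I t \<omega>) t \<omega>) \<partial>M)"

definition regret ::
  "'a measure \<Rightarrow> nat \<Rightarrow> nat \<Rightarrow> (nat \<Rightarrow> nat \<Rightarrow> 'a \<Rightarrow> real) \<Rightarrow> (nat \<Rightarrow> 'a \<Rightarrow> nat) \<Rightarrow> real" where
  "regret M K n g I = Max (regret_against M n g I ` {1..K})"

definition best_action ::
  "'a measure \<Rightarrow> nat \<Rightarrow> nat \<Rightarrow> (nat \<Rightarrow> nat \<Rightarrow> 'a \<Rightarrow> real) \<Rightarrow> (nat \<Rightarrow> 'a \<Rightarrow> nat) \<Rightarrow> nat \<Rightarrow> bool" where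
  "best_action M K n g I i \<longleftrightarrow> i \<in> {1..K} \<and> regret_against M n g I i = regret M K n g I"

definition normalise :: "nat \<Rightarrow> (nat \<Rightarrow> real) \<Rightarrow> nat \<Rightarrow> real" where
  "normalise K w i = w i / (\<Sum>j=1..K. w j)"

definition loss_estimate ::
  "(nat \<Rightarrow> real) \<Rightarrow> (nat \<Rightarrow> real) \<Rightarrow> nat \<Rightarrow> nat \<Rightarrow> real" where
  "loss_estimate p gain a i = (1 - gain i) * of_bool (a = i) / p i"

text \<open>
  The weight \<open>w\<^bsub>i,t\<^esub>\<close> along the path \<open>\<omega>\<close>. By the indicator in the loss estimate, it depends on the
  gains only through the observed \<open>g (I s \<omega>) s \<omega>\<close> for \<open>s \<le> t\<close>.
\<close>

primrec exp3_weight ::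
  "nat \<Rightarrow> (nat \<Rightarrow> real) \<Rightarrow> real \<Rightarrow> (nat \<Rightarrow> nat \<Rightarrow> 'a \<Rightarrow> real) \<Rightarrow> (nat \<Rightarrow> 'a \<Rightarrow> nat) \<Rightarrow>
    nat \<Rightarrow> 'a \<Rightarrow> nat \<Rightarrow> real" where
  "exp3_weight K \<rho> \<eta> g I 0 \<omega> = \<rho>"
| "exp3_weight K \<rho> \<eta> g I (Suc t) \<omega> = (\<lambda>i.
     exp3_weight K \<rho> \<eta> g I t \<omega> i *
     exp (- \<eta> * loss_estimate (normalise K (exp3_weight K \<rho> \<eta> g I t \<omega>))
                  (\<lambda>j. g j (Suc t) \<omega>) (I (Suc t) \<omega>) i))"

definition exp3_prob ::
  "nat \<Rightarrow> (nat \<Rightarrow> real) \<Rightarrow> real \<Rightarrow> (nat \<Rightarrow> nat \<Rightarrow> 'a \<Rightarrow> real) \<Rightarrow> (nat \<Rightarrow> 'a \<Rightarrow> nat) \<Rightarrow>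
    nat \<Rightarrow> nat \<Rightarrow> 'a \<Rightarrow> real" where
  "exp3_prob K \<rho> \<eta> g I i t \<omega> = normalise K (exp3_weight K \<rho> \<eta> g I (t - 1) \<omega>) i"

text \<open>
  The learner plays Exp3-\<open>\<gamma>\<close>: given the past, which includes the adversary's choice for round \<open>t\<close>,
  the action of round \<open>t\<close> is \<open>i\<close> with probability \<open>p\<^bsub>i,t\<^esub>\<close>.
\<close>

definition plays_exp3 ::
  "'a measure \<Rightarrow> (nat \<Rightarrow> 'a measure) \<Rightarrow> nat \<Rightarrow> nat \<Rightarrow> (nat \<Rightarrow> nat \<Rightarrow> 'a \<Rightarrow> real) \<Rightarrow>
    (nat \<Rightarrow> 'a \<Rightarrow> nat) \<Rightarrow> (nat \<Rightarrow> real) \<Rightarrow> real \<Rightarrow> bool" where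
  "plays_exp3 M F K n g I \<rho> \<eta> \<longleftrightarrow>
     (\<forall>t\<in>{1..n}. \<forall>i\<in>{1..K}. AE \<omega> in M.
        real_cond_exp M (F (t - 1)) (indicator {\<omega>' \<in> space M. I t \<omega>' = i}) \<omega> =
        exp3_prob K \<rho> \<eta> g I i t \<omega>)"

definition biased_prior :: "nat \<Rightarrow> nat \<Rightarrow> real \<Rightarrow> nat \<Rightarrow> real" where
  "biased_prior n K B\<^sub>1 i =
     (let \<rho>\<^sub>1 = exp (- (B\<^sub>1\<^sup>2 / (4 * real K * real n)))
      in if i = 1 then \<rho>\<^sub>1 else (1 - \<rho>\<^sub>1) / (real K - 1))"

end

theory Submission
  imports Defs
begin

text \<open>
  The potential \<open>ln (\<Sum>j. w\<^bsub>j,t\<^esub>)\<close> starts at \<open>0\<close> and is at least \<open>ln w\<^bsub>i,n\<^esub>\<close> at the end. From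
  \<open>exp (- x) \<le> 1 - x + x\<^sup>2 / 2\<close>, round \<open>t\<close> changes it by at most
  \<open>- \<eta> (1 - g\<^bsub>I\<^sub>t,t\<^esub>) + \<eta>\<^sup>2 / (2 p\<^bsub>I\<^sub>t,t\<^esub>)\<close>. Since the loss estimates are conditionally unbiased and
  \<open>1 / p\<^bsub>I\<^sub>t,t\<^esub>\<close> has expectation \<open>K\<close>, the regret against \<open>i\<close> is at most
  \<open>- ln \<rho>\<^sub>i / \<eta> + \<eta> K n / 2\<close>. For the given prior, with \<open>x = B\<^sub>1\<^sup>2 / (4 K n)\<close>, the inequality
  \<open>1 - exp (- x) \<ge> x exp (- x / 2)\<close> (that is, \<open>sinh y \<ge> y\<close>) bounds the term of an action \<open>i \<noteq> 1\<close>.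
\<close>

section \<open>Inequalities for the exponential and the change of the potential in one round\<close>

text \<open>The product of 1 + x + x^2/2 and 1 - x + x^2/2 is 1 + x^4/4, hence at least 1, and exp x
  is at least the first factor.\<close>

lemma exp_uminus_le_quadratic:
  fixes x :: real
  assumes "x \<ge> 0"
  shows "exp (- x) \<le> 1 - x + x\<^sup>2 / 2"
proof -
  have pos: "1 + x + x\<^sup>2 / 2 > 0"
    using assms by (simp add: add_pos_nonneg)
  have "0 \<le> x ^ 4"
    by simp
  then have "1 \<le> (1 + x + x\<^sup>2 / 2) * (1 - x + x\<^sup>2 / 2)"
    by (simp add: algebra_simps power2_eq_square power4_eq_xxxx)
  then have "1 / (1 + x + x\<^sup>2 / 2) \<le> 1 - x + x\<^sup>2 / 2"
    using pos by (simp add: divide_le_eq mult.commute)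
  moreover have "exp (- x) \<le> 1 / (1 + x + x\<^sup>2 / 2)"
    using exp_lower_Taylor_quadratic[OF assms] pos
    by (simp add: exp_minus inverse_eq_divide frac_le)
  ultimately show ?thesis
    by linarith
qed

lemma one_minus_exp_uminus_ge:
  fixes x :: real
  assumes "x \<ge> 0"
  shows "x * exp (- (x / 2)) \<le> 1 - exp (- x)"
proof -
  have "x \<le> exp (x / 2) - exp (- (x / 2))"
    using real_le_x_sinh[of "x / 2"] assms by (simp add: exp_minus)
  then have "x * exp (- (x / 2)) \<le> (exp (x / 2) - exp (- (x / 2))) * exp (- (x / 2))"
    by (rule mult_right_mono) simp
  also have "\<dots> = 1 - exp (- x)"
    by (simp add: left_diff_distrib flip: exp_add)
  finally show ?thesis .
qed

text \<open>Only the weight of the played action \<open>a\<close> changes, so the total is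
  multiplied by 1 + p (exp (- x) - 1) with \<open>x\<close> as defined below. The bound then follows
  from ln (1 + u) \<le> u, the quadratic bound on exp (- x), and (1 - \<open>gain a\<close>)^2 \<le>
  1.\<close>

lemma ln_sum_exp_loss_estimate_le:
  fixes w gain :: "nat \<Rightarrow> real"
  assumes w: "\<And>i. i \<in> {1..K} \<Longrightarrow> w i > 0" and a: "a \<in> {1..K}"
    and gain: "gain a \<in> {0..1}" and \<eta>: "\<eta> > 0"
  shows "ln (\<Sum>i=1..K. w i * exp (- \<eta> * loss_estimate (normalise K w) gain a i)) - ln (\<Sum>i=1..K. w i)
    \<le> - \<eta> * (1 - gain a) + \<eta>\<^sup>2 / 2 * (1 / normalise K w a)"
proof -
  define W where "W = (\<Sum>i=1..K. w i)"
  define p where "p = normalise K w a"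
  define x where "x = \<eta> * ((1 - gain a) / p)"
  define f where "f i = w i * exp (- \<eta> * loss_estimate (normalise K w) gain a i)" for i
  have W: "W > 0"
    unfolding W_def using a w by (intro sum_pos) auto
  have p: "p > 0" and wa: "w a = W * p"
    using W w[OF a] by (simp_all add: p_def normalise_def W_def)
  have x: "x \<ge> 0"
    using gain \<eta> p by (simp add: x_def)
  have "(\<Sum>i=1..K. f i) = f a + (\<Sum>i\<in>{1..K} - {a}. f i)"
    using a by (simp add: sum.remove)
  also have "(\<Sum>i\<in>{1..K} - {a}. f i) = (\<Sum>i\<in>{1..K} - {a}. w i)"
    by (intro sum.cong) (auto simp: f_def loss_estimate_def)
  also have "\<dots> = W - w a"
    using a by (simp add: W_def sum.remove)
  also have "f a = W * p * exp (- x)"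
    by (simp add: f_def loss_estimate_def x_def p_def[symmetric] wa)
  also have "W * p * exp (- x) + (W - w a) = W * (1 + p * (exp (- x) - 1))"
    by (simp add: wa algebra_simps)
  finally have sum_f: "(\<Sum>i=1..K. f i) = W * (1 + p * (exp (- x) - 1))" .
  moreover have "(\<Sum>i=1..K. f i) > 0"
    using a w by (intro sum_pos) (auto simp: f_def)
  ultimately have pos: "1 + p * (exp (- x) - 1) > 0"
    using W by (simp add: zero_less_mult_iff)
  have "ln (\<Sum>i=1..K. f i) - ln W = ln (1 + p * (exp (- x) - 1))"
    unfolding sum_f using pos W by (simp add: ln_mult)
  also have "\<dots> \<le> p * (exp (- x) - 1)"
    using ln_le_minus_one[OF pos] by simp
  also have "\<dots> \<le> p * (- x + x\<^sup>2 / 2)"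
    using exp_uminus_le_quadratic[OF x] p by (intro mult_left_mono) auto
  also have "\<dots> = - \<eta> * (1 - gain a) + \<eta>\<^sup>2 / 2 * ((1 - gain a)\<^sup>2 / p)"
    using p by (simp add: x_def field_simps power2_eq_square)
  also have "\<dots> \<le> - \<eta> * (1 - gain a) + \<eta>\<^sup>2 / 2 * (1 / p)"
    using gain p by (intro add_left_mono mult_left_mono divide_right_mono power_le_one) auto
  finally show ?thesis
    by (simp add: f_def W_def p_def)
qed

section \<open>The Exp3 process and bounds on its weights and probabilities\<close>

text \<open>The prior is kept general. Its strict positivity keeps all weights positive, so that the
  importance weights and the logarithms below are meaningful.\<close>

locale exp3 = adversarial_bandit +
  fixes \<rho> :: "nat \<Rightarrow> real" and \<eta> :: real
  assumes plays: "plays_exp3 M F K n g I \<rho> \<eta>"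
    and prior_pos: "\<And>i. i \<in> {1..K} \<Longrightarrow> \<rho> i > 0"
    and sum_prior: "(\<Sum>i=1..K. \<rho> i) = 1"
    and rate_pos: "\<eta> > 0"
begin

abbreviation weight :: "nat \<Rightarrow> 'a \<Rightarrow> nat \<Rightarrow> real" where
  "weight \<equiv> exp3_weight K \<rho> \<eta> g I"

abbreviation prob_of :: "nat \<Rightarrow> nat \<Rightarrow> 'a \<Rightarrow> real" where
  "prob_of \<equiv> exp3_prob K \<rho> \<eta> g I"

definition est :: "nat \<Rightarrow> nat \<Rightarrow> 'a \<Rightarrow> real" where
  "est i t \<omega> = loss_estimate (\<lambda>j. prob_of j t \<omega>) (\<lambda>j. g j t \<omega>) (I t \<omega>) i"

text \<open>\<open>exp3_prob\<close> at round \<open>Suc t\<close> normalises the weights of index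
  \<open>t\<close>, so \<open>est\<close> at \<open>Suc t\<close> is the estimate in the recursion
  for the weights.\<close>

lemma weight_Suc: "weight (Suc t) \<omega> i = weight t \<omega> i * exp (- \<eta> * est i (Suc t) \<omega>)"
  by (simp add: est_def exp3_prob_def)

lemma action_in: "t \<in> {1..n} \<Longrightarrow> \<omega> \<in> space M \<Longrightarrow> I t \<omega> \<in> {1..K}"
  using measurable_space[OF action_adapted, of t \<omega>] by (simp add: space_F)

lemma weight_pos: "i \<in> {1..K} \<Longrightarrow> weight t \<omega> i > 0"
  by (induction t) (simp_all add: prior_pos)

lemma weight_sum_pos: "i \<in> {1..K} \<Longrightarrow> (\<Sum>j=1..K. weight t \<omega> j) > 0"
  by (intro sum_pos weight_pos) auto

lemma prob_of_pos: "i \<in> {1..K} \<Longrightarrow> prob_of i t \<omega> > 0"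
  unfolding exp3_prob_def normalise_def by (intro divide_pos_pos weight_pos weight_sum_pos)

lemma est_nonneg:
  assumes "i \<in> {1..K}" "t \<in> {1..n}" "\<omega> \<in> space M"
  shows "est i t \<omega> \<ge> 0"
  using gain_range[OF assms] prob_of_pos[OF assms(1), of t \<omega>]
  by (auto simp: est_def loss_estimate_def)

text \<open>The estimates are nonnegative, so no weight ever grows, and the total starts at
  1.\<close>

lemma weight_sum_le_1:
  assumes "t \<le> n" "\<omega> \<in> space M"
  shows "(\<Sum>j=1..K. weight t \<omega> j) \<le> 1"
  using assms(1)
proof (induction t)
  case 0
  show ?case
    using sum_prior by simp
next
  case (Suc t)
  have "weight (Suc t) \<omega> j \<le> weight t \<omega> j" if "j \<in> {1..K}" for j
  proof -
    have "exp (- \<eta> * est j (Suc t) \<omega>) \<le> 1"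
      using est_nonneg[of j "Suc t" \<omega>] that Suc.prems assms(2) rate_pos by simp
    then show ?thesis
      unfolding weight_Suc using weight_pos[OF that, of t \<omega>] by (intro mult_left_le) auto
  qed
  then have "(\<Sum>j=1..K. weight (Suc t) \<omega> j) \<le> (\<Sum>j=1..K. weight t \<omega> j)"
    by (intro sum_mono) auto
  with Suc show ?case
    by simp
qed

text \<open>Normalising divides by a total that is at most 1. A lower bound on a weight is thus also
  one on the probability in the following round.\<close>

lemma weight_le_prob_of:
  assumes "t < n" "\<omega> \<in> space M" "i \<in> {1..K}"
  shows "weight t \<omega> i \<le> prob_of i (Suc t) \<omega>"
  using weight_sum_le_1[of t \<omega>] weight_sum_pos[OF assms(3), of t \<omega>] weight_pos[OF assms(3), of t \<omega>] assms
  by (simp add: exp3_prob_def normalise_def le_divide_eq mult_left_le)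

text \<open>A deterministic lower bound, so that the importance weights \<open>1 / p\<^bsub>i,t\<^esub>\<close> are integrable.\<close>

lemma weight_bounded_below:
  assumes "t \<le> n" "i \<in> {1..K}"
  shows "\<exists>c>0. \<forall>\<omega>\<in>space M. c \<le> weight t \<omega> i"
  using assms(1)
proof (induction t)
  case 0
  then show ?case
    using prior_pos[OF assms(2)] by auto
next
  case (Suc t)
  then obtain c where c: "c > 0" "\<And>\<omega>. \<omega> \<in> space M \<Longrightarrow> c \<le> weight t \<omega> i"
    by auto
  \<comment> \<open>The next constant: if the weight is at least \<open>c\<close>, so is the
    probability, the estimate is at most 1/c, and the update factor is at least exp (-
    \<eta>/c).\<close>
  have "c * exp (- \<eta> * (1 / c)) \<le> weight (Suc t) \<omega> i" if \<omega>: "\<omega> \<in> space M" for \<omega>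
  proof -
    have "c \<le> prob_of i (Suc t) \<omega>"
      using weight_le_prob_of[of t \<omega> i] c(2)[OF \<omega>] Suc.prems assms(2) \<omega> by simp
    moreover have "g i (Suc t) \<omega> \<in> {0..1}"
      using gain_range Suc.prems assms(2) \<omega> by simp
    ultimately have "est i (Suc t) \<omega> \<le> 1 / c"
      using c(1) by (auto simp: est_def loss_estimate_def intro!: frac_le)
    then have "exp (- \<eta> * (1 / c)) \<le> exp (- \<eta> * est i (Suc t) \<omega>)"
      using mult_left_mono[of "est i (Suc t) \<omega>" "1 / c" \<eta>] rate_pos by simp
    then show ?thesis
      unfolding weight_Suc using c(1) c(2)[OF \<omega>] by (intro mult_mono) auto
  qed
  then show ?case
    using c(1) by (intro exI[of _ "c * exp (- \<eta> * (1 / c))"]) auto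
qed

lemma prob_of_bounded_below:
  assumes "t \<in> {1..n}" "i \<in> {1..K}"
  shows "\<exists>c>0. \<forall>\<omega>\<in>space M. c \<le> prob_of i t \<omega>"
proof -
  obtain s where s: "t = Suc s" "s < n"
    using assms(1) by (cases t) auto
  show ?thesis
    using weight_bounded_below[of s i] weight_le_prob_of[of s _ i] s assms(2) by fastforce
qed

section \<open>The bound along a single path\<close>

text \<open>The final potential is compared with two quantities: the telescoped one-round bounds
  from above and the logarithm of the single weight of \<open>i\<close> from below. No expectation
  is taken yet, so the adversary's dependence on past actions does not matter here.\<close>

lemma sum_loss_le_sum_est:
  assumes "i \<in> {1..K}" "\<omega> \<in> space M"
  shows "(\<Sum>t=1..n. 1 - g (I t \<omega>) t \<omega>)
    \<le> - ln (\<rho> i) / \<eta> + (\<Sum>t=1..n. est i t \<omega>) + \<eta> / 2 * (\<Sum>t=1..n. 1 / prob_of (I t \<omega>) t \<omega>)"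
proof -
  define L where "L t = ln (\<Sum>j=1..K. weight t \<omega> j)" for t
  have "L m \<le> - \<eta> * (\<Sum>t=1..m. 1 - g (I t \<omega>) t \<omega>) + \<eta>\<^sup>2 / 2 * (\<Sum>t=1..m. 1 / prob_of (I t \<omega>) t \<omega>)"
    if "m \<le> n" for m
    using that
  proof (induction m)
    case 0
    show ?case
      using sum_prior by (simp add: L_def)
  next
    case (Suc m)
    have t: "Suc m \<in> {1..n}"
      using Suc.prems by simp
    note a = action_in[OF t assms(2)]
    have "L (Suc m) - L m \<le> - \<eta> * (1 - g (I (Suc m) \<omega>) (Suc m) \<omega>)
        + \<eta>\<^sup>2 / 2 * (1 / prob_of (I (Suc m) \<omega>) (Suc m) \<omega>)"
      using ln_sum_exp_loss_estimate_le[where w = "weight m \<omega>" and gain = "\<lambda>j. g j (Suc m) \<omega>",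
          OF weight_pos a gain_range[OF a t assms(2)] rate_pos]
      by (simp add: L_def exp3_prob_def)
    with Suc show ?case
      by (simp add: algebra_simps)
  qed
  then have upper: "L n \<le> - \<eta> * (\<Sum>t=1..n. 1 - g (I t \<omega>) t \<omega>) + \<eta>\<^sup>2 / 2 * (\<Sum>t=1..n. 1 / prob_of (I t \<omega>) t \<omega>)"
    by blast
  \<comment> \<open>This is the weight recursion in logarithmic form; being an identity, it needs no
    bound on the gains and hence no restriction on \<open>m\<close>.\<close>
  have "ln (weight m \<omega> i) = ln (\<rho> i) - \<eta> * (\<Sum>t=1..m. est i t \<omega>)" for m
  proof (induction m)
    case 0
    then show ?case
      by simp
  next
    case (Suc m)
    then show ?case
      using weight_pos[OF assms(1), of m \<omega>]
      by (simp add: weight_Suc ln_mult algebra_simps del: exp3_weight.simps)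
  qed
  moreover have "ln (weight n \<omega> i) \<le> L n"
    unfolding L_def using assms(1)
    by (intro ln_mono weight_pos member_le_sum less_imp_le) auto
  ultimately have "\<eta> * (\<Sum>t=1..n. 1 - g (I t \<omega>) t \<omega>)
      \<le> - ln (\<rho> i) + \<eta> * (\<Sum>t=1..n. est i t \<omega>) + \<eta>\<^sup>2 / 2 * (\<Sum>t=1..n. 1 / prob_of (I t \<omega>) t \<omega>)"
    using upper by simp
  also have "\<dots> = \<eta> * (- ln (\<rho> i) / \<eta> + (\<Sum>t=1..n. est i t \<omega>) + \<eta> / 2 * (\<Sum>t=1..n. 1 / prob_of (I t \<omega>) t \<omega>))"
    using rate_pos by (simp add: ring_distribs power2_eq_square)
  finally show ?thesis
    using rate_pos by (simp only: mult_le_cancel_left_pos)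
qed

section \<open>Measurability with respect to the past, and importance weighting\<close>

lemma measurable_F_mono: "s \<le> t \<Longrightarrow> f \<in> measurable (F s) N \<Longrightarrow> f \<in> measurable (F t) N"
  using sets_F_mono[of s t] by (auto simp: measurable_def space_F)

lemma action_event_measurable:
  assumes "t \<in> {1..n}" "i \<in> {1..K}"
  shows "{\<omega> \<in> space M. I t \<omega> = i} \<in> sets (F t)"
proof -
  have "I t -` {i} \<inter> space (F t) \<in> sets (F t)"
    using assms by (intro measurable_sets[OF action_adapted]) auto
  also have "I t -` {i} \<inter> space (F t) = {\<omega> \<in> space M. I t \<omega> = i}"
    by (auto simp: space_F)
  finally show ?thesis .
qed

lemma weight_measurable:
  assumes "t \<le> n" "i \<in> {1..K}"
  shows "(\<lambda>\<omega>. weight t \<omega> i) \<in> borel_measurable (F t)"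
  using assms
proof (induction t arbitrary: i)
  case 0
  then show ?case
    by simp
next
  case (Suc t)
  have w: "(\<lambda>\<omega>. weight t \<omega> j) \<in> borel_measurable (F (Suc t))" if "j \<in> {1..K}" for j
    using Suc that by (intro measurable_F_mono[of t "Suc t"]) auto
  have gm: "g i (Suc t) \<in> borel_measurable (F (Suc t))"
    using gain_predictable[of i "Suc t"] Suc.prems by (intro measurable_F_mono[of t "Suc t"]) auto
  have ev: "{\<omega> \<in> space (F (Suc t)). I (Suc t) \<omega> = i} \<in> sets (F (Suc t))"
    using action_event_measurable[of "Suc t" i] Suc.prems by (simp add: space_F)
  have "(\<lambda>\<omega>. of_bool (I (Suc t) \<omega> = i) :: real) \<in> borel_measurable (F (Suc t))"
    using ev by (simp add: of_bool_def)
  then show ?case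
    using w gm Suc.prems
    by (simp add: loss_estimate_def normalise_def) measurable
qed

text \<open>The probabilities of round \<open>t\<close> come from the weights of index
  \<open>t - 1\<close>, so they are fixed before the action is drawn. This is what allows
  conditioning on \<open>F (t - 1)\<close>.\<close>

lemma prob_of_measurable:
  assumes "t \<in> {1..n}" "i \<in> {1..K}"
  shows "prob_of i t \<in> borel_measurable (F (t - 1))"
proof -
  have "(\<lambda>\<omega>. weight (t - 1) \<omega> j) \<in> borel_measurable (F (t - 1))" if "j \<in> {1..K}" for j
    using assms that by (intro weight_measurable) auto
  then show ?thesis
    using assms(2) unfolding exp3_prob_def normalise_def
    by (intro borel_measurable_divide borel_measurable_sum) auto
qed

lemma measurable_from_F: "f \<in> measurable (F t) N \<Longrightarrow> f \<in> measurable M N"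
  by (rule measurable_from_subalg[OF past_subalgebra])

text \<open>Given the past, the quotient \<open>f\<close> / p is a constant factor and the indicator
  has conditional mean p, which cancels the denominator. Later \<open>f\<close> is either the loss
  of \<open>i\<close> or the constant 1.\<close>

lemma importance_weighting:
  assumes t: "t \<in> {1..n}" and i: "i \<in> {1..K}"
    and f: "f \<in> borel_measurable (F (t - 1))"
    and f_range: "\<And>\<omega>. \<omega> \<in> space M \<Longrightarrow> f \<omega> \<in> {0..1}"
  shows "integrable M (\<lambda>\<omega>. f \<omega> / prob_of i t \<omega> * of_bool (I t \<omega> = i))" (is ?int)
    and "(\<integral>\<omega>. f \<omega> / prob_of i t \<omega> * of_bool (I t \<omega> = i) \<partial>M) = (\<integral>\<omega>. f \<omega> \<partial>M)" (is ?eq)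
proof -
  interpret sub: finite_measure_subalgebra M "F (t - 1)"
    by unfold_locales (rule past_subalgebra)
  define E where "E = {\<omega> \<in> space M. I t \<omega> = i}"
  have ind: "of_bool (I t \<omega> = i) = (indicator E \<omega> :: real)" if "\<omega> \<in> space M" for \<omega>
    using that by (simp add: E_def indicator_def)
  have E: "E \<in> sets M"
    using action_event_measurable[OF t i] past_subalgebra[of t]
    by (auto simp: E_def subalgebra_def)
  have q: "(\<lambda>\<omega>. f \<omega> / prob_of i t \<omega>) \<in> borel_measurable (F (t - 1))"
    using f prob_of_measurable[OF t i] by measurable
  obtain c where c: "c > 0" "\<And>\<omega>. \<omega> \<in> space M \<Longrightarrow> c \<le> prob_of i t \<omega>"
    using prob_of_bounded_below[OF t i] by auto
  have "\<bar>f \<omega> / prob_of i t \<omega> * indicator E \<omega>\<bar> \<le> 1 / c" if "\<omega> \<in> space M" for \<omega>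
    using f_range[OF that] c(1) c(2)[OF that] by (auto simp: indicator_def intro!: frac_le)
  then have int: "integrable M (\<lambda>\<omega>. f \<omega> / prob_of i t \<omega> * indicator E \<omega>)"
    by (intro integrable_const_bound[of _ "1 / c"] AE_I2 borel_measurable_times
        measurable_from_F[OF q] borel_measurable_indicator E) simp
  then show ?int
    by (rule Bochner_Integration.integrable_cong[THEN iffD1, rotated -1]) (simp_all add: ind)
  have "(\<integral>\<omega>. f \<omega> / prob_of i t \<omega> * of_bool (I t \<omega> = i) \<partial>M) = (\<integral>\<omega>. f \<omega> / prob_of i t \<omega> * indicator E \<omega> \<partial>M)"
    by (intro Bochner_Integration.integral_cong) (simp_all add: ind)
  \<comment> \<open>Since \<open>f\<close> / p is measurable for the past and the product is
    integrable, the indicator may be replaced by its conditional expectation under the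
    integral.\<close>
  also have "\<dots> = (\<integral>\<omega>. f \<omega> / prob_of i t \<omega> * real_cond_exp M (F (t - 1)) (indicator E) \<omega> \<partial>M)"
    using E by (intro sub.real_cond_exp_intg(2)[symmetric] int q) auto
  also have "\<dots> = (\<integral>\<omega>. f \<omega> \<partial>M)"
  proof (rule integral_cong_AE)
    have "AE \<omega> in M. real_cond_exp M (F (t - 1)) (indicator E) \<omega> = prob_of i t \<omega>"
      using plays t i by (simp add: plays_exp3_def E_def)
    then show "AE \<omega> in M. f \<omega> / prob_of i t \<omega> * real_cond_exp M (F (t - 1)) (indicator E) \<omega> = f \<omega>"
    proof eventually_elim
      case (elim \<omega>)
      then show ?case
        using prob_of_pos[OF i, of t \<omega>] by simp
    qed
  qed (use measurable_from_F[OF q] measurable_from_F[OF f] in measurable)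
  finally show ?eq .
qed

section \<open>The expected regret against a fixed action\<close>

lemma regret_against_le:
  assumes i: "i \<in> {1..K}"
  shows "regret_against M n g I i \<le> - ln (\<rho> i) / \<eta> + \<eta> * real K * real n / 2"
proof -
  \<comment> \<open>The probability at the random action is split over the fixed actions, so that
    \<open>importance_weighting\<close> applies with \<open>f\<close> = 1. Each of the
    \<open>K\<close> terms has mean 1.\<close>
  define Q where "Q t \<omega> = (\<Sum>j=1..K. 1 / prob_of j t \<omega> * of_bool (I t \<omega> = j))" for t \<omega>
  have Q: "1 / prob_of (I t \<omega>) t \<omega> = Q t \<omega>" if "t \<in> {1..n}" "\<omega> \<in> space M" for t \<omega>
    using action_in[OF that] by (simp add: Q_def of_bool_def if_distrib sum.delta cong: if_cong)
  have int_Q: "integrable M (Q t)" "(\<integral>\<omega>. Q t \<omega> \<partial>M) = real K" if t: "t \<in> {1..n}" for t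
  proof -
    have int: "integrable M (\<lambda>\<omega>. 1 / prob_of j t \<omega> * of_bool (I t \<omega> = j))"
      and eq: "(\<integral>\<omega>. 1 / prob_of j t \<omega> * of_bool (I t \<omega> = j) \<partial>M) = 1" if "j \<in> {1..K}" for j
      using importance_weighting[OF t that, of "\<lambda>_. 1"] by (simp_all add: prob_space)
    show "integrable M (Q t)"
      unfolding Q_def by (intro Bochner_Integration.integrable_sum int)
    have "(\<integral>\<omega>. Q t \<omega> \<partial>M) = (\<Sum>j=1..K. 1)"
      unfolding Q_def using eq by (subst Bochner_Integration.integral_sum[OF int]) (simp_all del: times_divide_eq_left)
    then show "(\<integral>\<omega>. Q t \<omega> \<partial>M) = real K"
      by simp
  qed
  have est_eq: "est i t = (\<lambda>\<omega>. (1 - g i t \<omega>) / prob_of i t \<omega> * of_bool (I t \<omega> = i))" for t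
    by (simp add: est_def loss_estimate_def fun_eq_iff)
  have int_est: "integrable M (est i t)" "(\<integral>\<omega>. est i t \<omega> \<partial>M) = (\<integral>\<omega>. 1 - g i t \<omega> \<partial>M)" if t: "t \<in> {1..n}" for t
  proof -
    have "(\<lambda>\<omega>. 1 - g i t \<omega>) \<in> borel_measurable (F (t - 1))"
      using gain_predictable[OF i t] by measurable
    moreover have "1 - g i t \<omega> \<in> {0..1}" if "\<omega> \<in> space M" for \<omega>
      using gain_range[OF i t that] by simp
    ultimately show "integrable M (est i t)" "(\<integral>\<omega>. est i t \<omega> \<partial>M) = (\<integral>\<omega>. 1 - g i t \<omega> \<partial>M)"
      unfolding est_eq using importance_weighting[OF t i, of "\<lambda>\<omega>. 1 - g i t \<omega>"] by auto
  qed
  have int_g: "integrable M (g j t)" if "j \<in> {1..K}" "t \<in> {1..n}" for j t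
    using gain_range[OF that] measurable_from_F[OF gain_predictable[OF that]]
    by (intro integrable_const_bound[of _ 1]) auto
  have int_gI: "integrable M (\<lambda>\<omega>. g (I t \<omega>) t \<omega>)" if t: "t \<in> {1..n}" for t
  proof -
    \<comment> \<open>The same splitting over the value of the action reduces integrability of the
      received gain to that of each \<open>g j t\<close>.\<close>
    have "integrable M (\<lambda>\<omega>. \<Sum>j=1..K. g j t \<omega> * indicator {\<omega> \<in> space M. I t \<omega> = j} \<omega>)"
      using int_g action_event_measurable[OF t] past_subalgebra[of t] t
      by (intro Bochner_Integration.integrable_sum integrable_real_mult_indicator)
        (auto simp: subalgebra_def)
    moreover have "(\<Sum>j=1..K. g j t \<omega> * indicator {\<omega> \<in> space M. I t \<omega> = j} \<omega>) = g (I t \<omega>) t \<omega>" if "\<omega> \<in> space M" for \<omega>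
      using action_in[OF t that] that
      by (simp add: indicator_def of_bool_def if_distrib sum.delta cong: if_cong)
    ultimately show ?thesis
      by (simp cong: Bochner_Integration.integrable_cong)
  qed
  \<comment> \<open>\<open>A\<close> is the total estimation error for \<open>i\<close>, of mean 0
    by unbiasedness; \<open>B\<close> collects the second-order terms and has mean n K.\<close>
  define A where "A \<omega> = (\<Sum>t=1..n. est i t \<omega> - (1 - g i t \<omega>))" for \<omega>
  define B where "B \<omega> = (\<Sum>t=1..n. Q t \<omega>)" for \<omega>
  have A: "integrable M A"
    unfolding A_def by (intro Bochner_Integration.integrable_sum Bochner_Integration.integrable_diff
        integrable_const int_est(1) int_g i)
  have B: "integrable M B"
    unfolding B_def by (intro Bochner_Integration.integrable_sum int_Q(1))
  have "(\<integral>\<omega>. A \<omega> \<partial>M) = (\<Sum>t=1..n. \<integral>\<omega>. est i t \<omega> - (1 - g i t \<omega>) \<partial>M)"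
    unfolding A_def by (intro Bochner_Integration.integral_sum Bochner_Integration.integrable_diff
        integrable_const int_est(1) int_g i)
  also have "\<dots> = (\<Sum>t=1..n. 0)"
  proof (intro sum.cong refl)
    fix t assume t: "t \<in> {1..n}"
    show "(\<integral>\<omega>. est i t \<omega> - (1 - g i t \<omega>) \<partial>M) = 0"
      using Bochner_Integration.integral_diff[OF int_est(1)[OF t]
          Bochner_Integration.integrable_diff[OF integrable_const int_g[OF i t]], of 1] int_est(2)[OF t]
      by simp
  qed
  finally have EA: "(\<integral>\<omega>. A \<omega> \<partial>M) = 0"
    by simp
  have EB: "(\<integral>\<omega>. B \<omega> \<partial>M) = real n * real K"
    unfolding B_def using int_Q by (simp add: Bochner_Integration.integral_sum)
  have "regret_against M n g I i
      \<le> (\<integral>\<omega>. - ln (\<rho> i) / \<eta> + A \<omega> + \<eta> / 2 * B \<omega> \<partial>M)"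
    unfolding regret_against_def
  proof (rule integral_mono)
    fix \<omega> assume \<omega>: "\<omega> \<in> space M"
    have "(\<Sum>t=1..n. 1 / prob_of (I t \<omega>) t \<omega>) = B \<omega>"
      unfolding B_def using Q \<omega> by (intro sum.cong) auto
    \<comment> \<open>A difference of gains is the opposite difference of losses; subtracting the
      true losses of \<open>i\<close> from the path bound leaves the error \<open>A\<close>.\<close>
    with sum_loss_le_sum_est[OF i \<omega>]
    show "(\<Sum>t=1..n. g i t \<omega> - g (I t \<omega>) t \<omega>) \<le> - ln (\<rho> i) / \<eta> + A \<omega> + \<eta> / 2 * B \<omega>"
      by (simp add: A_def sum_subtractf)
  next
    show "integrable M (\<lambda>\<omega>. \<Sum>t=1..n. g i t \<omega> - g (I t \<omega>) t \<omega>)"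
      using i int_g int_gI by auto
    show "integrable M (\<lambda>\<omega>. - ln (\<rho> i) / \<eta> + A \<omega> + \<eta> / 2 * B \<omega>)"
      using A B by simp
  qed
  also have "\<dots> = - ln (\<rho> i) / \<eta> + \<eta> * real K * real n / 2"
    using A B by (simp add: EA EB prob_space)
  finally show ?thesis .
qed

end

section \<open>The biased prior and its learning rate\<close>

theorem corollary9:
  fixes n K :: nat and B\<^sub>1 :: real
    and M :: "'a measure" and F :: "nat \<Rightarrow> 'a measure"
    and g :: "nat \<Rightarrow> nat \<Rightarrow> 'a \<Rightarrow> real" and I :: "nat \<Rightarrow> 'a \<Rightarrow> nat" and i_star :: nat
  assumes "n \<ge> 1" and "K \<ge> 2" and "B\<^sub>1 > 0"
    and "adversarial_bandit M F K n g I"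
    and "plays_exp3 M F K n g I (biased_prior n K B\<^sub>1) (B\<^sub>1 / (2 * real K * real n))"
    and "best_action M K n g I i_star"
  shows "regret M K n g I \<le>
    (if i_star = 1 then B\<^sub>1
     else B\<^sub>1 / 2 + 2 * real K * real n / B\<^sub>1 *
            ln (4 * real K * real n * (real K - 1) / B\<^sub>1\<^sup>2))"
proof -
  define x where "x = B\<^sub>1\<^sup>2 / (4 * real K * real n)"
  define \<eta> where "\<eta> = B\<^sub>1 / (2 * real K * real n)"
  define \<rho> where "\<rho> = biased_prior n K B\<^sub>1"
  have x: "x > 0" and \<eta>: "\<eta> > 0"
    using assms(1-3) by (simp_all add: x_def \<eta>_def)
  have \<rho>_eq: "\<rho> i = (if i = 1 then exp (- x) else (1 - exp (- x)) / (real K - 1))" for i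
    by (simp add: \<rho>_def biased_prior_def x_def Let_def)
  have "{1..K} = insert 1 {2..K}"
    using assms(2) by auto
  then have "(\<Sum>i=1..K. \<rho> i) = \<rho> 1 + (\<Sum>i=2..K. \<rho> i)"
    by simp
  also have "(\<Sum>i=2..K. \<rho> i) = (\<Sum>i=2..K. (1 - exp (- x)) / (real K - 1))"
    by (intro sum.cong) (auto simp: \<rho>_eq)
  also have "\<rho> 1 + \<dots> = 1"
    using assms(2) by (simp add: \<rho>_eq of_nat_diff)
  finally have sum_\<rho>: "(\<Sum>i=1..K. \<rho> i) = 1" .
  interpret adversarial_bandit M F K n g I
    by fact
  interpret exp3 M F K n g I \<rho> \<eta>
  proof
    show "plays_exp3 M F K n g I \<rho> \<eta>"
      using assms(5) by (simp add: \<rho>_def \<eta>_def)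
    show "\<rho> i > 0" for i
      using x assms(2) by (simp add: \<rho>_eq)
  qed (fact sum_\<rho> \<eta>)+
  have "i_star \<in> {1..K}"
    using assms(6) by (simp add: best_action_def)
  then have bound: "regret M K n g I \<le> - ln (\<rho> i_star) / \<eta> + \<eta> * real K * real n / 2"
    using regret_against_le[of i_star] assms(6) by (simp only: best_action_def)
  \<comment> \<open>Here - ln (\<open>\<rho> 1\<close>) = x, so for action 1 the general bound is
    B1/2 + B1/4, which is below B1.\<close>
  have x_\<eta>: "x / \<eta> = B\<^sub>1 / 2" and \<eta>_half: "\<eta> * real K * real n / 2 = B\<^sub>1 / 4"
    using assms(1-3) by (simp_all add: x_def \<eta>_def field_simps power2_eq_square)
  show ?thesis
  proof (cases "i_star = 1")
    case True
    then show ?thesis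
      using bound x_\<eta> \<eta>_half assms(3) by (simp add: \<rho>_eq)
  next
    case False
    define R where "R = ln ((real K - 1) / x)"
    have "- ln (\<rho> i_star) = ln (real K - 1) - ln (1 - exp (- x))"
      using False x assms(2) by (simp add: \<rho>_eq ln_div)
    \<comment> \<open>Replacing 1 - exp (- x) by this lower bound adds x/2 to the logarithmic term
      \<open>R\<close>. After division by \<open>\<eta>\<close> that is B1/4, which together with
      the B1/4 from the second-order term gives the B1/2 of the claim.\<close>
    also have "\<dots> \<le> ln (real K - 1) - ln (x * exp (- (x / 2)))"
      using one_minus_exp_uminus_ge[of x] x by (intro diff_left_mono ln_mono) auto
    also have "\<dots> = R + x / 2"
      using x assms(2) by (simp add: R_def ln_mult ln_div)
    finally have "- ln (\<rho> i_star) / \<eta> \<le> (R + x / 2) / \<eta>"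
      using \<eta> by (intro divide_right_mono) auto
    also have "\<dots> = R / \<eta> + x / \<eta> / 2"
      by (simp add: add_divide_distrib)
    finally have "regret M K n g I \<le> R / \<eta> + B\<^sub>1 / 2"
      using bound x_\<eta> \<eta>_half by simp
    moreover have "R / \<eta> = 2 * real K * real n / B\<^sub>1 * ln (4 * real K * real n * (real K - 1) / B\<^sub>1\<^sup>2)"
      by (simp add: R_def x_def \<eta>_def mult.commute)
    ultimately show ?thesis
      using False by simp
  qed
qed

end
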